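(* Let $G$ be a simple non-abelian group and let $h$ be a nontrivial element of $G$. Then $[e]_h$ is not a subgroup of $G$.
   Context: For $h\in G$, $[e]_h=\{z^{-1}h^{-1}zh\mid z\in G\}$ is the twisted conjugacy class of the unit element $e$ with respect to the inner automorphism $x\mapsto h^{-1}xh$. *)

theory Defs
  imports "HOL-Algebra.SimpleGroups"
begin

text \<open>
  The library locale \<^locale>\<open>simple_group\<close> demands \<^prop>\<open>order G > 1\<close>. Since \<^const>\<open>order\<close> is defined
  by \<^const>\<open>card\<close>, which is 0 on infinite sets, it covers finite groups only. The following notion
  also includes infinite simple groups and agrees with the library on finite ones.
\<close>

definition is_simple_group :: "('a, 'b) monoid_scheme \<Rightarrow> bool" where
  "is_simple_group G \<longleftrightarrow>
     group G \<and> carrier G \<noteq> {\<one>\<^bsub>G\<^esub>} \<and>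
     (\<forall>H. H \<lhd> G \<longrightarrow> H = carrier G \<or> H = {\<one>\<^bsub>G\<^esub>})"

lemma is_simple_group_finite_iff:
  assumes "finite (carrier G)"
  shows "is_simple_group G \<longleftrightarrow> simple_group G"
proof
  assume s: "is_simple_group G"
  then interpret group G by (simp add: is_simple_group_def)
  have "\<not> order G \<le> 1"
  proof
    assume "order G \<le> 1"
    then have "card (carrier G) \<le> card {\<one>\<^bsub>G\<^esub>}" by (simp add: order_def)
    then have "{\<one>\<^bsub>G\<^esub>} = carrier G" using assms by (intro card_seteq) auto
    with s show False by (simp add: is_simple_group_def)
  qed
  then show "simple_group G"
    using s by unfold_locales (auto simp: is_simple_group_def)
next
  assume "simple_group G"
  then show "is_simple_group G"
    unfolding is_simple_group_def
    using simple_group.axioms(1) simple_group.simple_not_triv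
      simple_group.no_real_normal_subgroup by blast
qed

text \<open>
  The class of \<open>x\<close> under the relation identifying \<open>x\<close> with \<open>z\<^sup>-\<^sup>1 x \<phi>(z)\<close>.
\<close>

definition twisted_conj_class ::
    "('a, 'b) monoid_scheme \<Rightarrow> ('a \<Rightarrow> 'a) \<Rightarrow> 'a \<Rightarrow> 'a set" where
  "twisted_conj_class G \<phi> x =
     {inv\<^bsub>G\<^esub> z \<otimes>\<^bsub>G\<^esub> x \<otimes>\<^bsub>G\<^esub> \<phi> z | z. z \<in> carrier G}"

definition inner_aut :: "('a, 'b) monoid_scheme \<Rightarrow> 'a \<Rightarrow> 'a \<Rightarrow> 'a" where
  "inner_aut G h x = inv\<^bsub>G\<^esub> h \<otimes>\<^bsub>G\<^esub> x \<otimes>\<^bsub>G\<^esub> h"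

definition unit_twisted_class :: "('a, 'b) monoid_scheme \<Rightarrow> 'a \<Rightarrow> 'a set" where
  "unit_twisted_class G h = twisted_conj_class G (inner_aut G h) \<one>\<^bsub>G\<^esub>"

lemma (in group) unit_twisted_class_eq:
  assumes "h \<in> carrier G"
  shows "unit_twisted_class G h = {inv z \<otimes> inv h \<otimes> z \<otimes> h | z. z \<in> carrier G}"
proof -
  have "inv z \<otimes> \<one> \<otimes> (inv h \<otimes> z \<otimes> h) = inv z \<otimes> inv h \<otimes> z \<otimes> h" if "z \<in> carrier G" for z
    using that assms by (simp add: m_assoc)
  then show ?thesis
    unfolding unit_twisted_class_def twisted_conj_class_def inner_aut_def by force
qed

end

theory Submission
  imports Defs
begin

text \<open>
  Write \<open>g z = z\<^sup>-\<^sup>1 \<phi>(z)\<close>, so that the twisted class of the unit is the image of \<open>g\<close>. For an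
  endomorphism \<open>\<phi>\<close> the cocycle identity \<open>x\<^sup>-\<^sup>1 g(z) x = g(zx) g(x)\<^sup>-\<^sup>1\<close> holds, hence the image of
  \<open>g\<close> is normal as soon as it is a subgroup (\<open>normal_twisted_conj_class_one\<close>). In a simple group
  this leaves two cases for \<open>\<phi>(x) = h\<^sup>-\<^sup>1xh\<close>. If the class is trivial, then \<open>h\<close> is a nontrivial central
  element, so the centre is the whole group and the group is abelian. If the class is everything,
  then it contains \<open>h\<close>; but \<open>h = z\<^sup>-\<^sup>1h\<^sup>-\<^sup>1z h\<close> says that a conjugate of \<open>h\<^sup>-\<^sup>1\<close> is trivial, so \<open>h\<close>
  is trivial.
\<close>

text \<open>
  Since \<open>g(zx) = x\<^sup>-\<^sup>1 g(z) \<phi>(x)\<close> and \<open>\<phi>(x) = x g(x)\<close>, conjugating a value of \<open>g\<close> by \<open>x\<close> only costs a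
  factor that is the inverse of another value of \<open>g\<close>, and a subgroup absorbs it.
\<close>

lemma (in group) normal_twisted_conj_class_one:
  assumes hom: "\<phi> \<in> hom G G"
    and sub: "subgroup (twisted_conj_class G \<phi> \<one>) G"
  shows "twisted_conj_class G \<phi> \<one> \<lhd> G"
  unfolding normal_inv_iff
proof (intro conjI sub ballI)
  fix x a
  assume x: "x \<in> carrier G" and a: "a \<in> twisted_conj_class G \<phi> \<one>"
  define g where "g z = inv z \<otimes> \<one> \<otimes> \<phi> z" for z
  have class_eq: "twisted_conj_class G \<phi> \<one> = g ` carrier G"
    by (auto simp only: twisted_conj_class_def g_def)
  have \<phi>_closed [simp]: "\<phi> z \<in> carrier G" if "z \<in> carrier G" for z
    using hom that by (auto simp: hom_def)
  obtain z where z: "z \<in> carrier G" and a_eq: "a = g z"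
    using a by (auto simp: class_eq)
  \<comment> \<open>The normality criterion conjugates as \<open>x a x\<^sup>-\<^sup>1\<close>, so the cocycle identity is used at \<open>x\<^sup>-\<^sup>1\<close>.\<close>
  let ?y = "inv x"
  have "x \<otimes> a \<otimes> inv x = g (z \<otimes> ?y) \<otimes> inv (g ?y)"
  proof -
    have "\<phi> (z \<otimes> ?y) = \<phi> z \<otimes> \<phi> ?y"
      using hom x z by (simp add: hom_def)
    moreover have "\<phi> ?y \<otimes> (inv (\<phi> ?y) \<otimes> inv x) = inv x"
      using x by (simp add: m_assoc [symmetric])
    ultimately show ?thesis
      using x z by (simp add: a_eq g_def inv_mult_group m_assoc)
  qed
  moreover have "g (z \<otimes> ?y) \<in> twisted_conj_class G \<phi> \<one>" "g ?y \<in> twisted_conj_class G \<phi> \<one>"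
    using x z by (auto simp: class_eq)
  ultimately show "x \<otimes> a \<otimes> inv x \<in> twisted_conj_class G \<phi> \<one>"
    using sub by (simp add: subgroup.m_closed subgroup.m_inv_closed)
qed

lemma (in group) inner_aut_hom:
  assumes h: "h \<in> carrier G"
  shows "inner_aut G h \<in> hom G G"
proof (rule homI)
  fix x y
  assume "x \<in> carrier G" "y \<in> carrier G"
  moreover from this h have "h \<otimes> (inv h \<otimes> (y \<otimes> h)) = y \<otimes> h"
    by (simp add: m_assoc [symmetric])
  ultimately show "inner_aut G h (x \<otimes> y) = inner_aut G h x \<otimes> inner_aut G h y"
    using h by (simp add: inner_aut_def m_assoc)
qed (use h in \<open>simp add: inner_aut_def\<close>)

lemma (in group) normal_center:
  "{c \<in> carrier G. \<forall>x \<in> carrier G. c \<otimes> x = x \<otimes> c} \<lhd> G" (is "?Z \<lhd> G")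
proof -
  have "subgroup ?Z G"
  proof (rule subgroupI)
    show "inv c \<in> ?Z" if "c \<in> ?Z" for c
    proof -
      have "inv c \<otimes> x = x \<otimes> inv c" if x: "x \<in> carrier G" for x
      proof -
        have c: "c \<in> carrier G" "c \<otimes> inv x = inv x \<otimes> c"
          using \<open>c \<in> ?Z\<close> x by auto
        have "inv c \<otimes> x = inv (inv x \<otimes> c)" using c(1) x by (simp add: inv_mult_group)
        also have "\<dots> = inv (c \<otimes> inv x)" by (simp only: c(2))
        also have "\<dots> = x \<otimes> inv c" using c(1) x by (simp add: inv_mult_group)
        finally show ?thesis .
      qed
      with that show ?thesis by simp
    qed
    show "c \<otimes> d \<in> ?Z" if "c \<in> ?Z" "d \<in> ?Z" for c d
    proof -
      have "c \<otimes> d \<otimes> x = x \<otimes> (c \<otimes> d)" if x: "x \<in> carrier G" for x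
      proof -
        have cd: "c \<in> carrier G" "d \<in> carrier G" "c \<otimes> x = x \<otimes> c" "d \<otimes> x = x \<otimes> d"
          using \<open>c \<in> ?Z\<close> \<open>d \<in> ?Z\<close> x by auto
        have "c \<otimes> d \<otimes> x = c \<otimes> x \<otimes> d" using cd(1,2,4) x by (simp add: m_assoc)
        also have "\<dots> = x \<otimes> c \<otimes> d" using cd(3) by simp
        finally show ?thesis using cd(1,2) x by (simp add: m_assoc)
      qed
      moreover have "c \<otimes> d \<in> carrier G" using that by blast
      ultimately show ?thesis by blast
    qed
  qed (auto intro!: exI [of _ \<one>])
  moreover have "x \<otimes> c \<otimes> inv x = c" if "x \<in> carrier G" "c \<in> ?Z" for x c
  proof -
    have "x \<otimes> c \<otimes> inv x = c \<otimes> x \<otimes> inv x" using that by simp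
    moreover have "c \<in> carrier G" using that by blast
    ultimately show ?thesis using \<open>x \<in> carrier G\<close> by (simp add: m_assoc)
  qed
  ultimately show ?thesis by (simp add: normal_inv_iff)
qed

theorem theorem4:
  fixes G :: "('a, 'b) monoid_scheme" and h :: 'a
  assumes "is_simple_group G"
    and "\<not> comm_group G"
    and "h \<in> carrier G"
    and "h \<noteq> \<one>\<^bsub>G\<^esub>"
  shows "\<not> subgroup (unit_twisted_class G h) G"
proof
  assume sub: "subgroup (unit_twisted_class G h) G"
  interpret group G using assms(1) by (simp add: is_simple_group_def)
  note h = assms(3)
  have "unit_twisted_class G h \<lhd> G"
    using normal_twisted_conj_class_one [OF inner_aut_hom [OF h]] sub
    by (simp add: unit_twisted_class_def)
  then consider "unit_twisted_class G h = carrier G" | "unit_twisted_class G h = {\<one>\<^bsub>G\<^esub>}"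
    using assms(1) by (auto simp: is_simple_group_def)
  then show False
  proof cases
    case 1
    then have "h \<in> unit_twisted_class G h" using h by simp
    then obtain z where z: "z \<in> carrier G"
      and eq: "h = inv\<^bsub>G\<^esub> z \<otimes>\<^bsub>G\<^esub> inv\<^bsub>G\<^esub> h \<otimes>\<^bsub>G\<^esub> z \<otimes>\<^bsub>G\<^esub> h"
      unfolding unit_twisted_class_eq [OF h] by (elim CollectE exE conjE)
    have "inv\<^bsub>G\<^esub> z \<otimes>\<^bsub>G\<^esub> inv\<^bsub>G\<^esub> h \<otimes>\<^bsub>G\<^esub> z = \<one>\<^bsub>G\<^esub>"
      using h z by (intro iffD1 [OF r_cancel_one eq [symmetric]]) simp_all
    then have "inv\<^bsub>G\<^esub> z \<otimes>\<^bsub>G\<^esub> inv\<^bsub>G\<^esub> h = inv\<^bsub>G\<^esub> z"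
      using h z inv_equality [of "inv\<^bsub>G\<^esub> z \<otimes>\<^bsub>G\<^esub> inv\<^bsub>G\<^esub> h" z] by simp
    then have "inv\<^bsub>G\<^esub> h = \<one>\<^bsub>G\<^esub>" using h z by simp
    then show False using h assms(4) by simp
  next
    case 2
    let ?Z = "{c \<in> carrier G. \<forall>x \<in> carrier G. c \<otimes>\<^bsub>G\<^esub> x = x \<otimes>\<^bsub>G\<^esub> c}"
    have "h \<otimes>\<^bsub>G\<^esub> z = z \<otimes>\<^bsub>G\<^esub> h" if z: "z \<in> carrier G" for z
    proof -
      have "inv\<^bsub>G\<^esub> z \<otimes>\<^bsub>G\<^esub> inv\<^bsub>G\<^esub> h \<otimes>\<^bsub>G\<^esub> z \<otimes>\<^bsub>G\<^esub> h = \<one>\<^bsub>G\<^esub>"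
        using 2 z unfolding unit_twisted_class_eq [OF h] by blast
      then have "inv\<^bsub>G\<^esub> (h \<otimes>\<^bsub>G\<^esub> z) \<otimes>\<^bsub>G\<^esub> (z \<otimes>\<^bsub>G\<^esub> h) = \<one>\<^bsub>G\<^esub>"
        using h z by (simp add: inv_mult_group m_assoc)
      then show ?thesis
        using h z inv_solve_left [of "\<one>\<^bsub>G\<^esub>" "h \<otimes>\<^bsub>G\<^esub> z" "z \<otimes>\<^bsub>G\<^esub> h"] by simp
    qed
    then have "h \<in> ?Z" using h by simp
    then have "?Z = carrier G"
      using normal_center assms(1,4) unfolding is_simple_group_def by blast
    then have "comm_group G"
      by (intro group_comm_groupI) blast
    with assms(2) show False by simp
  qed
qed

end
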